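(* Let $(M_1,0),(M_2,0)\subset(\mathbb{C}^n,0)$ be irreducible germs of $n$-dimensional Segre nondegenerate real-analytic subvarieties, both of Segre multiplicity $k$, and let $\mathcal{R}_1,\mathcal{R}_2\colon\mathbb{C}\{\bar z\}\to\mathbb{C}\{z\}$ be their restricted averaging operators. If $\mathcal{R}_1\bar z^\beta=\mathcal{R}_2\bar z^\beta$ for every multi-index $\beta\in\mathbb{N}^n$ with $|\beta|\le k$, then $M_1=M_2$ (as germs at $0$).
   Context: $\mathbb{C}\{z\}$, $\mathbb{C}\{\bar z\}$, $\mathbb{C}\{z,\bar z\}$ denote the rings of convergent power series, i.e. germs at $0\in\mathbb{C}^n$ of holomorphic, antiholomorphic, respectively complex-valued real-analytic, functions. "$n$-dimensional" means of real dimension $n$. For a germ $(X,0)\subset(\mathbb{C}^n,0)$ of a real-analytic subvariety, $\mathcal{I}_0(X)\subset\mathbb{C}\{z,\bar z\}$ is the ideal of germs vanishing on $X$. $(X,0)$ is Segre nondegenerate if the ideal $\mathcal{J}=\{\varrho(z,0):\varrho\in\mathcal{I}_0(X)\}\subset\mathbb{C}\{z\}$ satisfies $\mathfrak{m}^s\subset\mathcal{J}$ for some $s\in\mathbb{N}$, $\mathfrak{m}$ being the maximal ideal (equivalently $V(\mathcal{J})=\{0\}$). The complexification $\mathcal{X}$ of $(X,0)$ is the germ at $0$ of the complex subvariety of $\mathbb{C}^n_z\times\mathbb{C}^n_\xi$ with ideal $\{\varrho(z,\xi):\varrho(z,\bar z)\in\mathcal{I}_0(X)\}$, i.e. the smallest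 germ of a complex subvariety containing $\{(z,\bar z):z\in X\}$; it has complex dimension $n$. Let $\pi_1(z,\xi)=z$. For suitable arbitrarily small polydiscs $\Delta_z,\Delta_\xi$ centered at $0$, $\mathcal{X}$ is represented by a closed irreducible subvariety of $\Delta_z\times\Delta_\xi$, $\pi_1|_{\mathcal{X}}$ is finite (proper with finite fibers) over $\Delta_z$, $(\pi_1|_{\mathcal{X}})^{-1}(0)=\{0\}$, and for each $z\in\Delta_z$ the fiber $(\pi_1|_{\mathcal{X}})^{-1}(z)$ consists of exactly $k$ points $(z,\xi^1(z)),\dots,(z,\xi^k(z))$ counted with multiplicity (generically distinct). The integer $k$ is the Segre multiplicity of $(X,0)$. The averaging operator $\mathcal{A}\colon\mathbb{C}\{z,\bar z\}\to\mathbb{C}\{z\}$ is $(\mathcal{A}f)(z)=\frac1k\sum_{j=1}^k f(z,\xi^j(z))$, where $f(z,\xi)$ is obtained from $f(z,\bar z)$ by replacing $\bar z$ by $\xi$. The restricted averaging operator is $\mathcal{R}=\mathcal{A}|_{\mathbb{C}\{\bar z\}}\colon\mathbb{C}\{\bar z\}\to\mathbb{C}\{z\}$. *)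

theory Defs
  imports "HOL-Analysis.Analysis" "HOL-Library.Multiset"
begin

text \<open>
  Conventions. A germ at a point is represented by a set or a function, and equality of germs
  is equality on a neighbourhood of the point. The space $\mathbb{C}^n_z \times \mathbb{C}^n_\xi$
  is \<open>complex ^ ('n + 'n)\<close>, with the point $(z, \xi)$ written \<open>joinv z \<xi>\<close>. An element
  $f(z,\bar z)$ of $\mathbb{C}\{z,\bar z\}$ is represented by the sum \<open>F\<close> of the
  convergent power series $f(z,\xi)$; the real-analytic function itself is
  \<open>\<lambda>z. F (joinv z (cnjv z))\<close>.
\<close>


subsection \<open>Convergent power series\<close>

definition vpow :: "complex ^ 'm::finite \<Rightarrow> ('m \<Rightarrow> nat) \<Rightarrow> complex" where
  "vpow z \<alpha> = (\<Prod>i\<in>UNIV. (z $ i) ^ \<alpha> i)"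

definition polydisc :: "('m::finite \<Rightarrow> real) \<Rightarrow> (complex ^ 'm) set" where
  "polydisc r = {z. \<forall>i. norm (z $ i) < r i}"

definition holo_at :: "(complex ^ 'm::finite \<Rightarrow> complex) \<Rightarrow> complex ^ 'm \<Rightarrow> bool" where
  "holo_at f p \<longleftrightarrow> (\<exists>c. \<exists>r>0. \<forall>w\<in>polydisc (\<lambda>_. r).
     ((\<lambda>\<alpha>. c \<alpha> * vpow w \<alpha>) has_sum f (p + w)) UNIV)"

definition cnjv :: "complex ^ 'n::finite \<Rightarrow> complex ^ 'n" where
  "cnjv z = (\<chi> i. cnj (z $ i))"

definition joinv :: "complex ^ 'n::finite \<Rightarrow> complex ^ 'n \<Rightarrow> complex ^ ('n + 'n)" where
  "joinv z \<xi> = (\<chi> i. case i of Inl j \<Rightarrow> z $ j | Inr j \<Rightarrow> \<xi> $ j)"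

definition proj1 :: "complex ^ ('n + 'n) \<Rightarrow> complex ^ 'n::finite" where
  "proj1 w = (\<chi> j. w $ Inl j)"

definition real_analytic_at :: "(complex ^ 'n::finite \<Rightarrow> complex) \<Rightarrow> complex ^ 'n \<Rightarrow> bool" where
  "real_analytic_at f p \<longleftrightarrow> (\<exists>F. holo_at F (joinv p (cnjv p)) \<and>
     (\<forall>\<^sub>F z in nhds p. f z = F (joinv z (cnjv z))))"


subsection \<open>Complex subvarieties of open sets\<close>

text \<open>Taking \<open>p\<close> in \<open>\<Omega>\<close> outside \<open>A\<close> in the following definition shows that \<open>A\<close> is
  relatively closed in \<open>\<Omega>\<close>.\<close>

definition complex_subvariety :: "(complex ^ 'm::finite) set \<Rightarrow> (complex ^ 'm) set \<Rightarrow> bool" where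
  "complex_subvariety \<Omega> A \<longleftrightarrow> A \<subseteq> \<Omega> \<and>
     (\<forall>p\<in>\<Omega>. \<exists>N S. open N \<and> p \<in> N \<and> N \<subseteq> \<Omega> \<and> finite S \<and>
        (\<forall>f\<in>S. \<forall>q\<in>N. holo_at f q) \<and> A \<inter> N = {q\<in>N. \<forall>f\<in>S. f q = 0})"

definition irreducible_complex_subvariety ::
    "(complex ^ 'm::finite) set \<Rightarrow> (complex ^ 'm) set \<Rightarrow> bool" where
  "irreducible_complex_subvariety \<Omega> A \<longleftrightarrow> complex_subvariety \<Omega> A \<and> A \<noteq> {} \<and>
     (\<forall>A1 A2. complex_subvariety \<Omega> A1 \<and> complex_subvariety \<Omega> A2 \<and> A = A1 \<union> A2
        \<longrightarrow> A = A1 \<or> A = A2)"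


subsection \<open>Germs of real-analytic subvarieties at the origin\<close>

definition germ_eq :: "(complex ^ 'n::finite) set \<Rightarrow> (complex ^ 'n) set \<Rightarrow> bool" where
  "germ_eq X Y \<longleftrightarrow> (\<forall>\<^sub>F z in nhds 0. z \<in> X \<longleftrightarrow> z \<in> Y)"

definition real_subvariety_germ :: "(complex ^ 'n::finite) set \<Rightarrow> bool" where
  "real_subvariety_germ X \<longleftrightarrow> 0 \<in> X \<and>
     (\<exists>N S. open N \<and> 0 \<in> N \<and> finite S \<and> (\<forall>f\<in>S. \<forall>q\<in>N. real_analytic_at f q) \<and>
        X \<inter> N = {q\<in>N. \<forall>f\<in>S. f q = 0})"

definition irreducible_germ :: "(complex ^ 'n::finite) set \<Rightarrow> bool" where
  "irreducible_germ X \<longleftrightarrow> real_subvariety_germ X \<and>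
     (\<forall>A B. real_subvariety_germ A \<and> real_subvariety_germ B \<and> germ_eq X (A \<union> B)
        \<longrightarrow> germ_eq X A \<or> germ_eq X B)"

text \<open>Near \<open>p\<close>, the set \<open>X\<close> is a real-analytic submanifold of real dimension \<open>d\<close>: it is
  cut out by $2n - d$ real-valued real-analytic functions with independent differentials.\<close>

definition regular_point :: "(complex ^ 'n::finite) set \<Rightarrow> complex ^ 'n \<Rightarrow> nat \<Rightarrow> bool" where
  "regular_point X p d \<longleftrightarrow> p \<in> X \<and> d \<le> 2 * CARD('n) \<and>
     (\<exists>N (\<rho> :: nat \<Rightarrow> complex ^ 'n \<Rightarrow> real) D. open N \<and> p \<in> N \<and>
        (\<forall>j < 2 * CARD('n) - d.
           (\<forall>q\<in>N. real_analytic_at (\<lambda>z. complex_of_real (\<rho> j z)) q) \<and>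
           (\<rho> j has_derivative D j) (at p)) \<and>
        (\<forall>a :: nat \<Rightarrow> real. (\<forall>v. (\<Sum>j < 2 * CARD('n) - d. a j * D j v) = 0)
           \<longrightarrow> (\<forall>j < 2 * CARD('n) - d. a j = 0)) \<and>
        X \<inter> N = {q\<in>N. \<forall>j < 2 * CARD('n) - d. \<rho> j q = 0})"

text \<open>The largest dimension of regular points occurring arbitrarily close to the origin.\<close>

definition germ_dim :: "(complex ^ 'n::finite) set \<Rightarrow> nat" where
  "germ_dim X = Max {d. \<exists>\<^sub>F p in nhds 0. regular_point X p d}"

text \<open>The ideal $\mathcal{I}_0(X)$, with \<open>F\<close> standing for $\varrho(z,\xi)$.\<close>

definition real_ideal :: "(complex ^ 'n::finite) set \<Rightarrow> (complex ^ ('n + 'n) \<Rightarrow> complex) set" where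
  "real_ideal X = {F. holo_at F 0 \<and> (\<forall>\<^sub>F z in nhds 0. z \<in> X \<longrightarrow> F (joinv z (cnjv z)) = 0)}"


subsection \<open>Segre nondegeneracy\<close>

definition max_ideal :: "(complex ^ 'n::finite \<Rightarrow> complex) set" where
  "max_ideal = {g. holo_at g 0 \<and> g 0 = 0}"

definition max_ideal_power :: "nat \<Rightarrow> (complex ^ 'n::finite \<Rightarrow> complex) set" where
  "max_ideal_power s = {g. \<exists>(m::nat) a h.
     (\<forall>i<m. holo_at (a i) 0 \<and> (\<forall>j<s. h i j \<in> max_ideal)) \<and>
     (\<forall>\<^sub>F z in nhds 0. g z = (\<Sum>i<m. a i z * (\<Prod>j<s. h i j z)))}"

definition segre_ideal :: "(complex ^ 'n::finite) set \<Rightarrow> (complex ^ 'n \<Rightarrow> complex) set" where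
  "segre_ideal X = {g. \<exists>F\<in>real_ideal X. \<forall>\<^sub>F z in nhds 0. g z = F (joinv z 0)}"

definition segre_nondegenerate :: "(complex ^ 'n::finite) set \<Rightarrow> bool" where
  "segre_nondegenerate X \<longleftrightarrow> (\<exists>s. max_ideal_power s \<subseteq> segre_ideal X)"


subsection \<open>Complexification, Segre multiplicity and averaging\<close>

definition complex_ideal :: "(complex ^ 'm::finite) set \<Rightarrow> (complex ^ 'm \<Rightarrow> complex) set" where
  "complex_ideal W = {F. holo_at F 0 \<and> (\<forall>\<^sub>F w in nhds 0. w \<in> W \<longrightarrow> F w = 0)}"

definition fibre :: "(complex ^ ('n + 'n)) set \<Rightarrow> complex ^ 'n::finite \<Rightarrow> (complex ^ 'n) set" where
  "fibre W z = {\<xi>. joinv z \<xi> \<in> W}"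

text \<open>\<open>W\<close> represents the complexification of \<open>X\<close> in the product of the polydiscs of polyradii
  \<open>rz\<close> and \<open>rx\<close>, the projection to the first factor is finite, and \<open>\<Xi> z\<close> is the multiset of
  the \<open>k\<close> points $\xi^1(z),\dots,\xi^k(z)$. Outside a proper subvariety \<open>E\<close> these points are
  distinct; the multiplicity of a point of an arbitrary fibre is the number of points of
  the nearby fibres outside \<open>E\<close> that lie close to it.\<close>

definition segre_representation ::
    "(complex ^ 'n::finite) set \<Rightarrow> nat \<Rightarrow> ('n \<Rightarrow> real) \<Rightarrow> ('n \<Rightarrow> real) \<Rightarrow>
     (complex ^ ('n + 'n)) set \<Rightarrow> (complex ^ 'n \<Rightarrow> (complex ^ 'n) multiset) \<Rightarrow> bool" where
  "segre_representation X k rz rx W \<Xi> \<longleftrightarrow>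
     (\<forall>i. 0 < rz i \<and> 0 < rx i) \<and>
     irreducible_complex_subvariety (polydisc (case_sum rz rx)) W \<and>
     complex_ideal W = real_ideal X \<and>
     (\<forall>K. compact K \<and> K \<subseteq> polydisc rz \<longrightarrow> compact {w\<in>W. proj1 w \<in> K}) \<and>
     (\<forall>z\<in>polydisc rz. finite (fibre W z)) \<and>
     fibre W 0 = {0} \<and>
     (\<forall>z\<in>polydisc rz. set_mset (\<Xi> z) = fibre W z \<and> size (\<Xi> z) = k) \<and>
     (\<exists>E. complex_subvariety (polydisc rz) E \<and> E \<noteq> polydisc rz \<and>
        (\<forall>z\<in>polydisc rz - E. card (fibre W z) = k) \<and>
        (\<forall>z\<in>polydisc rz. \<forall>\<xi>\<in>fibre W z. \<forall>\<^sub>F e in at_right 0.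
           \<forall>\<^sub>F z' in at z within (polydisc rz - E).
             card (fibre W z' \<inter> ball \<xi> e) = count (\<Xi> z) \<xi>))"

definition has_segre_multiplicity :: "(complex ^ 'n::finite) set \<Rightarrow> nat \<Rightarrow> bool" where
  "has_segre_multiplicity X k \<longleftrightarrow> (\<forall>\<epsilon>>0. \<exists>rz rx W \<Xi>.
     (\<forall>i. rz i < \<epsilon> \<and> rx i < \<epsilon>) \<and> segre_representation X k rz rx W \<Xi>)"

text \<open>Two representations of the complexification have the same fibres, with multiplicity, over
  all \<open>z\<close> near the origin. So the choice below does not affect the germs at the origin
  of the functions returned by the averaging operators.\<close>

definition segre_fibre :: "(complex ^ 'n::finite) set \<Rightarrow> nat \<Rightarrow> complex ^ 'n \<Rightarrow> (complex ^ 'n) multiset" where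
  "segre_fibre X k = (SOME \<Xi>. \<exists>rz rx W. segre_representation X k rz rx W \<Xi>)"

definition averaging ::
    "(complex ^ 'n::finite) set \<Rightarrow> nat \<Rightarrow> (complex ^ ('n + 'n) \<Rightarrow> complex) \<Rightarrow> complex ^ 'n \<Rightarrow> complex" where
  "averaging X k F z = (1 / of_nat k) * (\<Sum>\<xi>\<in>#segre_fibre X k z. F (joinv z \<xi>))"

text \<open>The element $h(\bar z)$ of $\mathbb{C}\{\bar z\}$ is represented by the holomorphic \<open>h\<close>, so
  $\bar z^\beta$ is \<open>\<lambda>\<xi>. vpow \<xi> \<beta>\<close>.\<close>

definition restricted_averaging ::
    "(complex ^ 'n::finite) set \<Rightarrow> nat \<Rightarrow> (complex ^ 'n \<Rightarrow> complex) \<Rightarrow> complex ^ 'n \<Rightarrow> complex" where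
  "restricted_averaging X k h = averaging X k (\<lambda>w. h (\<chi> j. w $ Inr j))"

end

theory Submission
  imports Defs "HOL-Computational_Algebra.Polynomial_FPS"
begin

text \<open>
  The averages of the monomials of degree at most \<open>k\<close> are, up to the factor $1/k$, the power sums
  of the \<open>k\<close> points $\xi^1(z),\dots,\xi^k(z)$ of the Segre fibre over \<open>z\<close>. By Newton's identities,
  \<open>k\<close> complex numbers are determined by their power sums of exponents \<open>1\<close> to \<open>k\<close>. Composing with
  affine functions on $\mathbb{C}^n$, whose powers of exponent at most \<open>k\<close> are combinations of
  monomials of degree at most \<open>k\<close>, carries this over to points of $\mathbb{C}^n$
  (\<open>set_mset_eq_if_moments_eq\<close>): an affine function can be chosen to take the value \<open>1\<close> at a given
  point and at none of finitely many others.

  Hence the complexifications of $M_1$ and $M_2$ have the same fibres over all \<open>z\<close> near the origin,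
  which means that they coincide there and that the ideals $\mathcal{I}_0(M_1)$ and
  $\mathcal{I}_0(M_2)$ are equal (\<open>complex_ideal_eq_if_fibres_eq\<close>). A germ of a real-analytic
  subvariety is the zero set of its ideal, so it is determined by the latter
  (\<open>germ_eq_if_real_ideal_eq\<close>).
\<close>


section \<open>Power sums of complex numbers\<close>

text \<open>The constant term is \<open>1\<close>, so that Newton's identities below determine all the other
  coefficients; the roots are the inverses of the nonzero elements.\<close>

definition reciprocal_root_poly :: "complex multiset \<Rightarrow> complex poly" where
  "reciprocal_root_poly A = (\<Prod>x\<in>#A. [:1, - x:])"

definition power_sum :: "complex multiset \<Rightarrow> nat \<Rightarrow> complex" where
  "power_sum A m = (\<Sum>x\<in>#A. x ^ m)"

lemma reciprocal_root_poly_add_mset [simp]: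
  "reciprocal_root_poly (add_mset x A) = [:1, - x:] * reciprocal_root_poly A"
  by (simp add: reciprocal_root_poly_def)

lemma degree_reciprocal_root_poly: "degree (reciprocal_root_poly A) \<le> size A"
proof (induction A)
  case empty
  show ?case by (simp add: reciprocal_root_poly_def)
next
  case (add x A)
  have "degree (reciprocal_root_poly (add_mset x A))
      \<le> degree [:1, - x:] + degree (reciprocal_root_poly A)"
    unfolding reciprocal_root_poly_add_mset by (rule degree_mult_le)
  also have "\<dots> \<le> size (add_mset x A)" using add.IH by simp
  finally show ?case .
qed

lemma poly_reciprocal_root_poly_one: "poly (reciprocal_root_poly A) 1 = 0 \<longleftrightarrow> 1 \<in># A"
proof (induction A)
  case empty
  show ?case by (simp add: reciprocal_root_poly_def)
next
  case (add x A)
  then show ?case by auto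
qed

text \<open>Newton's identities, as the logarithmic derivative of $E = \prod_j (1 - x_j t)$, whose factor
  $1 - x t$ contributes $-x/(1 - x t) = -\sum_m x^{m+1} t^m$.\<close>

lemma newton_identities_fps:
  "fps_deriv (fps_of_poly (reciprocal_root_poly A))
   = - fps_of_poly (reciprocal_root_poly A) * Abs_fps (\<lambda>m. power_sum A (Suc m))"
proof (induction A)
  case empty
  have "Abs_fps (\<lambda>m. power_sum {#} (Suc m)) = 0"
    by (rule fps_ext) (simp add: power_sum_def)
  then show ?case by (simp add: reciprocal_root_poly_def)
next
  case (add x A)
  define E where "E = fps_of_poly (reciprocal_root_poly A)"
  define S where "S = Abs_fps (\<lambda>m. power_sum A (Suc m))"
  define G where "G = Abs_fps (\<lambda>m. x ^ Suc m)"
  define L where "L = 1 - fps_const x * fps_X"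
  have sum: "Abs_fps (\<lambda>m. power_sum (add_mset x A) (Suc m)) = G + S"
    by (rule fps_ext) (simp add: power_sum_def G_def S_def)
  have fac: "fps_of_poly [:1, - x:] = L"
    by (simp add: L_def fps_of_poly_pCons)
  have geometric: "L * G = fps_const x"
  proof (rule fps_ext)
    fix n
    show "fps_nth (L * G) n = fps_nth (fps_const x) n"
      by (cases n) (simp_all add: L_def G_def algebra_simps)
  qed
  have "fps_deriv (L * E) = - fps_const x * E - L * (E * S)"
    using add.IH by (simp add: E_def S_def L_def algebra_simps)
  also have "\<dots> = - (L * G) * E - L * (E * S)"
    by (simp add: geometric)
  also have "\<dots> = - (L * E) * (G + S)"
    by (simp add: algebra_simps)
  finally show ?case
    by (simp only: reciprocal_root_poly_add_mset fps_of_poly_mult sum fac E_def)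
qed

lemma newton_identities:
  "of_nat (Suc n) * coeff (reciprocal_root_poly A) (Suc n)
   = - (\<Sum>i\<le>n. coeff (reciprocal_root_poly A) i * power_sum A (Suc (n - i)))"
  using arg_cong[OF newton_identities_fps, of "\<lambda>f. fps_nth f n" A]
  by (simp add: fps_mult_nth sum_negf atLeast0AtMost)

text \<open>Newton's identities are a recursion for the coefficients, in characteristic \<open>0\<close>. The power sums
  of exponent at most \<open>k\<close> determine the coefficients up to index \<open>k\<close>, and there are no others.\<close>

lemma reciprocal_root_poly_eq_if_power_sums_eq:
  assumes size: "size A \<le> k" "size B \<le> k"
    and sums: "\<And>m. m \<le> k \<Longrightarrow> power_sum A m = power_sum B m"
  shows "reciprocal_root_poly A = reciprocal_root_poly B"
proof (rule poly_eqI)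
  fix n
  show "coeff (reciprocal_root_poly A) n = coeff (reciprocal_root_poly B) n"
  proof (cases "n \<le> k")
    case True
    then show ?thesis
    proof (induction n rule: less_induct)
      case (less n)
      show ?case
      proof (cases n)
        case 0
        have "coeff (reciprocal_root_poly C) 0 = 1" for C
          by (induction C) (simp_all add: reciprocal_root_poly_def)
        then show ?thesis by (simp add: 0)
      next
        case (Suc l)
        have "of_nat (Suc l) * coeff (reciprocal_root_poly A) (Suc l)
            = of_nat (Suc l) * coeff (reciprocal_root_poly B) (Suc l)"
          unfolding newton_identities using less Suc sums
          by (auto intro!: sum.cong)
        then show ?thesis
          unfolding Suc by (metis mult_cancel_left of_nat_eq_0_iff nat.distinct(1))
      qed
    qed
  next
    case False
    then show ?thesis
      using size degree_reciprocal_root_poly[of A] degree_reciprocal_root_poly[of B]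
      by (simp add: coeff_eq_0)
  qed
qed


section \<open>Moments of finitely many points\<close>

lemma sum_mset_sum_swap:
  fixes f :: "'a \<Rightarrow> 'b \<Rightarrow> 'c::comm_monoid_add"
  shows "(\<Sum>x\<in>#A. \<Sum>i\<in>I. f x i) = (\<Sum>i\<in>I. \<Sum>x\<in>#A. f x i)"
  by (induction A) (simp_all add: sum.distrib)

lemma vpow_mult_coordinate:
  "vpow \<xi> \<beta> * \<xi> $ i = vpow \<xi> (\<beta>(i := Suc (\<beta> i)))"
proof -
  have "vpow \<xi> (\<beta>(i := Suc (\<beta> i)))
      = (\<xi> $ i) ^ Suc (\<beta> i) * (\<Prod>j\<in>UNIV - {i}. (\<xi> $ j) ^ \<beta> j)"
    unfolding vpow_def by (subst prod.remove[of UNIV i]) auto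
  moreover have "vpow \<xi> \<beta> = (\<xi> $ i) ^ \<beta> i * (\<Prod>j\<in>UNIV - {i}. (\<xi> $ j) ^ \<beta> j)"
    unfolding vpow_def by (subst prod.remove[of UNIV i]) auto
  ultimately show ?thesis by simp
qed

text \<open>Expanding one factor \<open>c + (\<Sum>i. a i * \<xi> $ i)\<close> of the power raises the degree of the monomial
  in front by at most one; the monomial is there to make this an induction on \<open>m\<close>.\<close>

lemma affine_moments_eq:
  fixes A B :: "(complex ^ 'n::finite) multiset"
  assumes moments: "\<And>\<beta>. (\<Sum>i\<in>UNIV. \<beta> i) \<le> k \<Longrightarrow>
      (\<Sum>\<xi>\<in>#A. vpow \<xi> \<beta>) = (\<Sum>\<xi>\<in>#B. vpow \<xi> \<beta>)"
    and "(\<Sum>i\<in>UNIV. \<beta> i) + m \<le> k"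
  shows "(\<Sum>\<xi>\<in>#A. vpow \<xi> \<beta> * (c + (\<Sum>i\<in>UNIV. a i * \<xi> $ i)) ^ m)
       = (\<Sum>\<xi>\<in>#B. vpow \<xi> \<beta> * (c + (\<Sum>i\<in>UNIV. a i * \<xi> $ i)) ^ m)"
  using assms(2)
proof (induction m arbitrary: \<beta>)
  case 0
  then show ?case using moments by simp
next
  case (Suc m)
  define L where "L \<xi> = c + (\<Sum>i\<in>UNIV. a i * \<xi> $ i)" for \<xi> :: "complex ^ 'n"
  define \<beta>' where "\<beta>' i = \<beta>(i := Suc (\<beta> i))" for i
  have expand: "vpow \<xi> \<beta> * L \<xi> ^ Suc m = c * (vpow \<xi> \<beta> * L \<xi> ^ m)
      + (\<Sum>i\<in>UNIV. a i * (vpow \<xi> (\<beta>' i) * L \<xi> ^ m))" for \<xi>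
  proof -
    have "vpow \<xi> \<beta> * L \<xi> ^ Suc m = (c + (\<Sum>i\<in>UNIV. a i * \<xi> $ i)) * (vpow \<xi> \<beta> * L \<xi> ^ m)"
      by (simp add: L_def)
    then show ?thesis
      unfolding distrib_right sum_distrib_right \<beta>'_def vpow_mult_coordinate[symmetric]
      by (simp only: mult_ac)
  qed
  have split: "(\<Sum>\<xi>\<in>#C. vpow \<xi> \<beta> * L \<xi> ^ Suc m)
      = c * (\<Sum>\<xi>\<in>#C. vpow \<xi> \<beta> * L \<xi> ^ m)
        + (\<Sum>i\<in>UNIV. a i * (\<Sum>\<xi>\<in>#C. vpow \<xi> (\<beta>' i) * L \<xi> ^ m))" for C
    by (simp only: expand sum_mset.distrib sum_mset_sum_swap sum_mset_distrib_left)
  have "(\<Sum>j\<in>UNIV. \<beta>' i j) = Suc (\<Sum>j\<in>UNIV. \<beta> j)" for i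
    unfolding \<beta>'_def by (subst (1 2) sum.remove[of UNIV i]) auto
  then have IH: "(\<Sum>\<xi>\<in>#A. vpow \<xi> (\<beta>' i) * L \<xi> ^ m) = (\<Sum>\<xi>\<in>#B. vpow \<xi> (\<beta>' i) * L \<xi> ^ m)" for i
    using Suc.IH[of "\<beta>' i"] Suc.prems unfolding L_def by simp
  have IH0: "(\<Sum>\<xi>\<in>#A. vpow \<xi> \<beta> * L \<xi> ^ m) = (\<Sum>\<xi>\<in>#B. vpow \<xi> \<beta> * L \<xi> ^ m)"
    using Suc.IH[of \<beta>] Suc.prems unfolding L_def by simp
  show ?case
    unfolding L_def[symmetric] split IH IH0 ..
qed

text \<open>A vector space over an infinite field is not a finite union of hyperplanes: the functional \<open>a\<close>
  found for \<open>V\<close> is changed by \<open>t\<close> times a coordinate that does not vanish at the new vector \<open>v\<close>, and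
  only finitely many values of \<open>t\<close> are bad for some element of \<open>insert v V\<close>.\<close>

lemma functional_nonzero_on_finite_set:
  fixes V :: "(complex ^ 'n::finite) set"
  assumes "finite V" "0 \<notin> V"
  shows "\<exists>a :: 'n \<Rightarrow> complex. \<forall>v\<in>V. (\<Sum>i\<in>UNIV. a i * v $ i) \<noteq> 0"
  using assms
proof (induction V rule: finite_induct)
  case empty
  show ?case by simp
next
  case (insert v V)
  define val where "val a u = (\<Sum>i\<in>UNIV. a i * u $ i)" for a :: "'n \<Rightarrow> complex" and u
  from insert obtain a where a: "\<And>u. u \<in> V \<Longrightarrow> val a u \<noteq> 0"
    unfolding val_def by auto
  obtain p where p: "v $ p \<noteq> 0"
    using insert.prems by (metis insertI1 vec_eq_iff zero_index)
  define bad where "bad = (\<lambda>u. - val a u / u $ p) ` insert v V"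
  have "finite bad" using insert.hyps by (simp add: bad_def)
  then obtain t :: complex where t: "t \<notin> bad"
    using infinite_UNIV_char_0 ex_new_if_finite by metis
  define a' where "a' = a(p := a p + t)"
  have val': "val a' u = val a u + t * u $ p" for u
  proof -
    have "val a' u = (a p + t) * u $ p + (\<Sum>i\<in>UNIV - {p}. a i * u $ i)"
      unfolding val_def a'_def by (subst sum.remove[of UNIV p]) auto
    moreover have "val a u = a p * u $ p + (\<Sum>i\<in>UNIV - {p}. a i * u $ i)"
      unfolding val_def by (subst sum.remove[of UNIV p]) auto
    ultimately show ?thesis by (simp add: algebra_simps)
  qed
  have "val a' u \<noteq> 0" if u: "u \<in> insert v V" for u
  proof (cases "u $ p = 0")
    case True
    then show ?thesis using u a p val' by auto
  next
    case False
    have "t = - val a u / u $ p" if "val a u + t * u $ p = 0"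
    proof -
      have "t * u $ p = - val a u" using that by (simp add: eq_neg_iff_add_eq_0 add.commute)
      then show ?thesis using False by (metis nonzero_mult_div_cancel_right)
    qed
    moreover have "t \<noteq> - val a u / u $ p" using t u by (auto simp: bad_def)
    ultimately show ?thesis unfolding val' by blast
  qed
  then show ?case unfolding val_def by blast
qed

lemma set_mset_subset_if_moments_eq:
  fixes A B :: "(complex ^ 'n::finite) multiset"
  assumes size: "size A \<le> k" "size B \<le> k"
    and moments: "\<And>\<beta>. (\<Sum>i\<in>UNIV. \<beta> i) \<le> k \<Longrightarrow>
      (\<Sum>\<xi>\<in>#A. vpow \<xi> \<beta>) = (\<Sum>\<xi>\<in>#B. vpow \<xi> \<beta>)"
  shows "set_mset A \<subseteq> set_mset B"
proof (rule subsetI, rule ccontr)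
  fix \<eta> assume \<eta>: "\<eta> \<in># A" "\<eta> \<notin># B"
  have "0 \<notin> (\<lambda>\<xi>. \<xi> - \<eta>) ` set_mset B"
    using \<eta>(2) by auto
  then obtain a where a: "\<And>\<xi>. \<xi> \<in># B \<Longrightarrow> (\<Sum>i\<in>UNIV. a i * (\<xi> - \<eta>) $ i) \<noteq> 0"
    using functional_nonzero_on_finite_set[of "(\<lambda>\<xi>. \<xi> - \<eta>) ` set_mset B"] by auto
  \<comment> \<open>The constant makes the affine function \<open>L\<close> equal to \<open>1\<close> at \<open>\<eta>\<close>, and \<open>1\<close> is the point at
    which \<open>poly_reciprocal_root_poly_one\<close> tells the two multisets of values apart.\<close>
  define c where "c = 1 - (\<Sum>i\<in>UNIV. a i * \<eta> $ i)"
  define L where "L \<xi> = c + (\<Sum>i\<in>UNIV. a i * \<xi> $ i)" for \<xi> :: "complex ^ 'n"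
  have L: "L \<xi> = 1 + (\<Sum>i\<in>UNIV. a i * (\<xi> - \<eta>) $ i)" for \<xi>
    by (simp add: L_def c_def algebra_simps sum_subtractf)
  have "power_sum (image_mset L A) m = power_sum (image_mset L B) m" if "m \<le> k" for m
    using affine_moments_eq[OF moments, where \<beta> = "\<lambda>_. 0" and m = m and c = c and a = a] that
    by (simp add: power_sum_def L_def vpow_def multiset.map_comp comp_def)
  then have "reciprocal_root_poly (image_mset L A) = reciprocal_root_poly (image_mset L B)"
    using size by (intro reciprocal_root_poly_eq_if_power_sums_eq[of _ k]) auto
  moreover have "1 \<in># image_mset L A"
    using \<eta>(1) L[of \<eta>] by force
  ultimately have "1 \<in># image_mset L B"
    by (metis poly_reciprocal_root_poly_one)
  then show False using a L by auto
qed

lemma set_mset_eq_if_moments_eq: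
  fixes A B :: "(complex ^ 'n::finite) multiset"
  assumes "size A \<le> k" "size B \<le> k"
    and "\<And>\<beta>. (\<Sum>i\<in>UNIV. \<beta> i) \<le> k \<Longrightarrow>
      (\<Sum>\<xi>\<in>#A. vpow \<xi> \<beta>) = (\<Sum>\<xi>\<in>#B. vpow \<xi> \<beta>)"
  shows "set_mset A = set_mset B"
  using assms by (intro equalityI set_mset_subset_if_moments_eq[of _ k]) auto


section \<open>Fibres determine the complexification, and ideals determine the germ\<close>

lemma joinv_cnjv_zero: "joinv 0 (cnjv 0) = 0"
  by (simp add: joinv_def cnjv_def vec_eq_iff split: sum.split)

lemma mem_iff_fibre: "w \<in> W \<longleftrightarrow> (\<chi> j. w $ Inr j) \<in> fibre W (proj1 w)"
proof -
  have "joinv (proj1 w) (\<chi> j. w $ Inr j) = w"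
    by (simp add: joinv_def proj1_def vec_eq_iff split: sum.split)
  then show ?thesis by (simp add: fibre_def)
qed

lemma tendsto_proj1_zero: "(proj1 \<longlongrightarrow> (0 :: complex ^ 'n::finite)) (nhds 0)"
proof (rule vec_tendstoI)
  fix j
  have "((\<lambda>w :: complex ^ ('n + 'n). w $ Inl j) \<longlongrightarrow> (0 :: complex ^ ('n + 'n)) $ Inl j) (nhds 0)"
    by (rule tendsto_vec_nth[OF filterlim_ident])
  then show "((\<lambda>w :: complex ^ ('n + 'n). proj1 w $ j) \<longlongrightarrow> 0 $ j) (nhds 0)"
    by (simp add: proj1_def)
qed

lemma complex_ideal_eq_if_fibres_eq:
  assumes "\<forall>\<^sub>F z in nhds 0. fibre W1 z = fibre W2 z"
  shows "complex_ideal W1 = complex_ideal W2"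
proof -
  have "\<forall>\<^sub>F w in nhds 0. fibre W1 (proj1 w) = fibre W2 (proj1 w)"
    using tendsto_proj1_zero assms by (auto simp: filterlim_iff)
  then have W: "\<forall>\<^sub>F w in nhds 0. w \<in> W1 \<longleftrightarrow> w \<in> W2"
    by eventually_elim (metis mem_iff_fibre)
  have "(\<forall>\<^sub>F w in nhds 0. w \<in> W1 \<longrightarrow> F w = 0) \<longleftrightarrow> (\<forall>\<^sub>F w in nhds 0. w \<in> W2 \<longrightarrow> F w = 0)"
    for F :: "complex ^ ('a + 'a) \<Rightarrow> complex"
    by (rule eventually_cong[OF W]) simp
  then show ?thesis by (simp add: complex_ideal_def)
qed

text \<open>The power series of the functions that define \<open>X\<close> near the origin belong to \<open>real_ideal X\<close>, hence
  these functions vanish on \<open>Y\<close>.\<close>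

lemma germ_inclusion_if_real_ideal_subset:
  assumes "real_subvariety_germ X" "real_ideal X \<subseteq> real_ideal Y"
  shows "\<forall>\<^sub>F z in nhds 0. z \<in> Y \<longrightarrow> z \<in> X"
proof -
  obtain N S where N: "open N" "0 \<in> N" "finite S"
    and analytic: "\<And>f q. f \<in> S \<Longrightarrow> q \<in> N \<Longrightarrow> real_analytic_at f q"
    and X: "X \<inter> N = {q\<in>N. \<forall>f\<in>S. f q = 0}"
    using assms(1) unfolding real_subvariety_germ_def by blast
  have inN: "\<forall>\<^sub>F z in nhds 0. z \<in> N"
    using N by (simp add: eventually_nhds_in_open)
  have vanish: "\<forall>\<^sub>F z in nhds 0. z \<in> Y \<longrightarrow> f z = 0" if f: "f \<in> S" for f
  proof -
    obtain F where F: "holo_at F 0" and fF: "\<forall>\<^sub>F z in nhds 0. f z = F (joinv z (cnjv z))"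
      using analytic[OF f N(2)] unfolding real_analytic_at_def joinv_cnjv_zero by blast
    have "\<forall>\<^sub>F z in nhds 0. z \<in> X \<longrightarrow> F (joinv z (cnjv z)) = 0"
      using inN fF by eventually_elim (use X f in force)
    then have "F \<in> real_ideal Y"
      using F assms(2) unfolding real_ideal_def by blast
    then have "\<forall>\<^sub>F z in nhds 0. z \<in> Y \<longrightarrow> F (joinv z (cnjv z)) = 0"
      by (simp add: real_ideal_def)
    with fF show ?thesis by eventually_elim simp
  qed
  have "\<forall>\<^sub>F z in nhds 0. \<forall>f\<in>S. z \<in> Y \<longrightarrow> f z = 0"
    using N(3) vanish by (intro eventually_ball_finite) auto
  with inN show ?thesis by eventually_elim (use X in auto)
qed

lemma germ_eq_if_real_ideal_eq:
  assumes "real_subvariety_germ X" "real_subvariety_germ Y" "real_ideal X = real_ideal Y"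
  shows "germ_eq X Y"
  using germ_inclusion_if_real_ideal_subset[of X Y] germ_inclusion_if_real_ideal_subset[of Y X] assms
  unfolding germ_eq_def by (auto elim: eventually_elim2)


section \<open>The averages determine the germ\<close>

lemma segre_fibre_representation:
  assumes "has_segre_multiplicity X k"
  obtains rz rx W where "segre_representation X k rz rx W (segre_fibre X k)"
proof -
  have "\<exists>\<Xi> rz rx W. segre_representation X k rz rx W \<Xi>"
    using assms unfolding has_segre_multiplicity_def by (meson zero_less_one)
  then have "\<exists>rz rx W. segre_representation X k rz rx W (segre_fibre X k)"
    unfolding segre_fibre_def by (rule someI_ex)
  then show thesis using that by blast
qed

lemma eventually_in_polydisc:
  fixes r :: "'n::finite \<Rightarrow> real"
  assumes "\<And>i. 0 < r i"
  shows "\<forall>\<^sub>F z in nhds 0. z \<in> polydisc r"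
proof -
  have "\<forall>\<^sub>F z in nhds (0 :: complex ^ 'n). norm (z $ i) < r i" for i
  proof (rule order_tendstoD(2))
    have "((\<lambda>z :: complex ^ 'n. norm (z $ i)) \<longlongrightarrow> norm ((0 :: complex ^ 'n) $ i)) (nhds 0)"
      by (intro tendsto_norm tendsto_vec_nth filterlim_ident)
    then show "((\<lambda>z :: complex ^ 'n. norm (z $ i)) \<longlongrightarrow> 0) (nhds 0)" by simp
  qed (rule assms)
  then show ?thesis by (simp add: polydisc_def eventually_all_finite)
qed

lemma segre_representation_fibre:
  assumes "segre_representation X k rz rx W \<Xi>"
  shows "\<forall>\<^sub>F z in nhds 0. set_mset (\<Xi> z) = fibre W z \<and> size (\<Xi> z) = k"
proof -
  have "\<forall>\<^sub>F z in nhds 0. z \<in> polydisc rz"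
    using assms by (intro eventually_in_polydisc) (simp add: segre_representation_def)
  then show ?thesis
    by eventually_elim (use assms in \<open>simp add: segre_representation_def\<close>)
qed

text \<open>The fibre over the origin is not empty. With \<open>k = 0\<close> every average would be \<open>0\<close>, because of
  the division by \<open>k\<close>, and carry no information on the power sums.\<close>

lemma segre_multiplicity_positive:
  assumes "segre_representation X k rz rx W \<Xi>"
  shows "k > 0"
proof -
  have "set_mset (\<Xi> 0) = fibre W 0 \<and> size (\<Xi> 0) = k"
    using segre_representation_fibre[OF assms] by (rule eventually_nhds_x_imp_x)
  moreover have "fibre W 0 = {0}"
    using assms by (simp add: segre_representation_def)
  ultimately show ?thesis by (metis gr0I insert_not_empty set_mset_empty size_eq_0_iff_empty)
qed

lemma finite_multi_indices_degree_le: "finite {\<beta> :: 'n::finite \<Rightarrow> nat. (\<Sum>i\<in>UNIV. \<beta> i) \<le> k}"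
proof (rule finite_subset)
  show "{\<beta> :: 'n \<Rightarrow> nat. (\<Sum>i\<in>UNIV. \<beta> i) \<le> k} \<subseteq> {\<beta>. \<forall>i. \<beta> i \<in> {..k}}"
  proof safe
    fix \<beta> :: "'n \<Rightarrow> nat" and i assume "(\<Sum>i\<in>UNIV. \<beta> i) \<le> k"
    moreover have "\<beta> i \<le> (\<Sum>i\<in>UNIV. \<beta> i)" by (rule member_le_sum) auto
    ultimately show "\<beta> i \<le> k" by linarith
  qed
  show "finite {\<beta> :: 'n \<Rightarrow> nat. \<forall>i. \<beta> i \<in> {..k}}"
    using finite_set_of_finite_funs[of "UNIV :: 'n set" "{..k}" 0] by simp
qed

theorem theorem5p2:
  fixes M1 M2 :: "(complex ^ 'n::finite) set" and k :: nat
  assumes "irreducible_germ M1" and "irreducible_germ M2"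
    and "germ_dim M1 = CARD('n)" and "germ_dim M2 = CARD('n)"
    and "segre_nondegenerate M1" and "segre_nondegenerate M2"
    and "has_segre_multiplicity M1 k" and "has_segre_multiplicity M2 k"
    and "\<And>\<beta> :: 'n \<Rightarrow> nat. (\<Sum>i\<in>UNIV. \<beta> i) \<le> k \<Longrightarrow>
           (\<forall>\<^sub>F z in nhds 0. restricted_averaging M1 k (\<lambda>\<xi>. vpow \<xi> \<beta>) z
                           = restricted_averaging M2 k (\<lambda>\<xi>. vpow \<xi> \<beta>) z)"
  shows "germ_eq M1 M2"
proof -
  obtain rz1 rx1 W1 where rep1: "segre_representation M1 k rz1 rx1 W1 (segre_fibre M1 k)"
    using segre_fibre_representation[OF assms(7)] .
  obtain rz2 rx2 W2 where rep2: "segre_representation M2 k rz2 rx2 W2 (segre_fibre M2 k)"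
    using segre_fibre_representation[OF assms(8)] .
  have average: "restricted_averaging M k (\<lambda>\<xi>. vpow \<xi> \<beta>) z
      = (\<Sum>\<xi>\<in>#segre_fibre M k z. vpow \<xi> \<beta>) / of_nat k" for M :: "(complex ^ 'n) set" and \<beta> z
    by (simp add: restricted_averaging_def averaging_def joinv_def)
  have "\<forall>\<^sub>F z in nhds 0. \<forall>\<beta>\<in>{\<beta> :: 'n \<Rightarrow> nat. (\<Sum>i\<in>UNIV. \<beta> i) \<le> k}.
      restricted_averaging M1 k (\<lambda>\<xi>. vpow \<xi> \<beta>) z = restricted_averaging M2 k (\<lambda>\<xi>. vpow \<xi> \<beta>) z"
    using finite_multi_indices_degree_le assms(9) by (intro eventually_ball_finite) auto
  then have "\<forall>\<^sub>F z in nhds 0. fibre W1 z = fibre W2 z"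
    using segre_representation_fibre[OF rep1] segre_representation_fibre[OF rep2]
  proof eventually_elim
    case (elim z)
    have "(\<Sum>\<xi>\<in>#segre_fibre M1 k z. vpow \<xi> \<beta>) = (\<Sum>\<xi>\<in>#segre_fibre M2 k z. vpow \<xi> \<beta>)"
      if "(\<Sum>i\<in>UNIV. \<beta> i) \<le> k" for \<beta> :: "'n \<Rightarrow> nat"
      using elim(1) that segre_multiplicity_positive[OF rep1] by (simp add: average)
    then have "set_mset (segre_fibre M1 k z) = set_mset (segre_fibre M2 k z)"
      using elim by (intro set_mset_eq_if_moments_eq[of _ k]) auto
    then show ?case using elim by simp
  qed
  then have "complex_ideal W1 = complex_ideal W2"
    by (rule complex_ideal_eq_if_fibres_eq)
  then have "real_ideal M1 = real_ideal M2"
    using rep1 rep2 by (simp add: segre_representation_def)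
  then show ?thesis
    using assms(1,2) by (intro germ_eq_if_real_ideal_eq) (simp_all add: irreducible_germ_def)
qed

end
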